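(* Let $C$ be a commutative Noetherian ring containing a field of characteristic zero, let $n,m\ge1$, and let $R=C[X_1,\dots,X_n,Y_1,\dots,Y_m]$ with its standard $\mathbb{Z}^2$-grading. Let $M=\bigoplus_{(u,v)\in\mathbb{Z}^2}M_{(u,v)}$ be a bigraded generalized Eulerian $A_{n,m}(C)$-module. Let $\mathcal{R}$ be one of the following subsets of $\mathbb{Z}^2$: $$\mathcal{NE}=\{u\ge0,v\ge0\},\quad \mathcal{NW^*}=\{u\le-n,v\ge0\},\quad \mathcal{S^*W^*}=\{u\le-n,v\le-m\},\quad \mathcal{S^*E}=\{u\ge0,v\le-m\}.$$ Then the following are equivalent: (a) there exists $(u_0,v_0)\in\mathcal{R}$ such that $M_{(u,v)}\ne0$ for all $(u,v)\in\mathfrak{B}_{(u_0,v_0)}$; (b) $M_{(u,v)}\neq0$ for all $(u,v)\in\mathcal{R}$; (c) $M_{(u_1,v_1)}\ne0$ for some $(u_1,v_1)\in\mathcal{R}$.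
   Context: For $(u_0,v_0)\in\mathbb{Z}^2$, the block $\mathfrak{B}_{(u_0,v_0)}$ is the set of $(u,v)\in\mathbb{Z}^2$ such that $u\ge u_0$ if $u_0\ge0$, $u\le u_0$ if $u_0\le-n$, $v\ge v_0$ if $v_0\ge0$, and $v\le v_0$ if $v_0\le-m$. $A_{n,m}(C)=R\langle \partial_1,\dots,\partial_n,\delta_1,\dots,\delta_m\rangle$ is the Weyl algebra over $C$, with $\partial_i=\partial/\partial X_i$, $\delta_j=\partial/\partial Y_j$. Both $R$ and $A_{n,m}(C)$ are $\mathbb{Z}^2$-graded by $\operatorname{bideg} c=(0,0)$ for $c\in C$, $\operatorname{bideg} X_i=(1,0)$, $\operatorname{bideg} Y_j=(0,1)$, $\operatorname{bideg}\partial_i=(-1,0)$, $\operatorname{bideg}\delta_j=(0,-1)$. Put $\mathcal{E}^X_n=\sum_{i=1}^n X_i\partial_i$ and $\mathcal{E}^Y_m=\sum_{j=1}^m Y_j\delta_j$. A bigraded (left) $A_{n,m}(C)$-module $E$ is generalized Eulerian if for each bihomogeneous $e\in E$ with $\operatorname{bideg} e=(u,v)$ there is an integer $a>0$ with $(\mathcal{E}^X_n-u)^a e=0$ and $(\mathcal{E}^Y_m-v)^a e=0$. *)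

theory Defs
  imports Complex_Main "HOL-Library.Poly_Mapping" "HOL-Library.Cardinality"
begin

text \<open>
  The ideals of a commutative ring are its submodules, with multiplication as scalar action.
\<close>

definition noetherian_type :: "'c::comm_ring_1 itself \<Rightarrow> bool" where
  "noetherian_type _ \<longleftrightarrow>
     (\<forall>I :: 'c set. module.subspace (*) I \<longrightarrow> (\<exists>S. finite S \<and> module.span (*) S = I))"

definition is_subfield :: "'c::comm_ring_1 set \<Rightarrow> bool" where
  "is_subfield K \<longleftrightarrow>
     0 \<in> K \<and> 1 \<in> K \<and> (\<forall>x\<in>K. \<forall>y\<in>K. x + y \<in> K \<and> x * y \<in> K) \<and> (\<forall>x\<in>K. - x \<in> K) \<and>
     (\<forall>x\<in>K. x \<noteq> 0 \<longrightarrow> (\<exists>y\<in>K. x * y = 1))"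

text \<open>A subfield shares its unit, and hence its characteristic, with the ambient ring.\<close>

definition contains_char_0_field :: "'c::comm_ring_1 itself \<Rightarrow> bool" where
  "contains_char_0_field _ \<longleftrightarrow>
     (\<exists>K :: 'c set. is_subfield K \<and> (\<forall>k::nat. k > 0 \<longrightarrow> (of_nat k :: 'c) \<noteq> 0))"


text \<open>
  The ring $R = C[X_1,\dots,X_n,Y_1,\dots,Y_m]$, with $C$ the type \<open>'c\<close>, $n$ = \<open>CARD('n)\<close> and
  $m$ = \<open>CARD('m)\<close>: a variable is \<open>Inl i\<close> (for $X_i$) or \<open>Inr j\<close> (for $Y_j$), a monomial is a
  finitely supported exponent vector, and the multiplication of \<open>Poly_Mapping\<close> is convolution.
\<close>

type_synonym ('c, 'n, 'm) mpol = "(('n + 'm) \<Rightarrow>\<^sub>0 nat) \<Rightarrow>\<^sub>0 'c"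

type_synonym ('c, 'n, 'm) oper = "('c, 'n, 'm) mpol \<Rightarrow> ('c, 'n, 'm) mpol"

definition Const :: "'c::comm_ring_1 \<Rightarrow> ('c, 'n, 'm) mpol" where
  "Const c = Poly_Mapping.single 0 c"

definition Var :: "'n + 'm \<Rightarrow> ('c::comm_ring_1, 'n, 'm) mpol" where
  "Var k = Poly_Mapping.single (Poly_Mapping.single k 1) 1"

text \<open>
  Partial derivative with respect to the variable \<open>k\<close>. The truncated subtraction of exponents is
  harmless: if \<open>k\<close> does not occur in \<open>t\<close>, then the coefficient is \<open>0\<close>.
\<close>

definition pdiff :: "'n + 'm \<Rightarrow> ('c::comm_ring_1, 'n, 'm) oper" where
  "pdiff k p = (\<Sum>t\<in>Poly_Mapping.keys p.
     Poly_Mapping.single (t - Poly_Mapping.single k 1)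
       (of_nat (Poly_Mapping.lookup t k) * Poly_Mapping.lookup p t))"

lemma pdiff_single:
  "pdiff k (Poly_Mapping.single t c) =
     Poly_Mapping.single (t - Poly_Mapping.single k 1) (of_nat (Poly_Mapping.lookup t k) * c)"
  by (simp add: pdiff_def)


text \<open>
  The Weyl algebra $A_{n,m}(C) = R\langle\partial_1,\dots,\partial_n,\delta_1,\dots,\delta_m\rangle$:
  the subring of the additive endomorphisms of $R$ generated by the multiplications by elements of
  $R$ and by the partial derivatives. Its addition is pointwise and its product is composition.
\<close>

inductive_set weyl :: "('c::comm_ring_1, 'n, 'm) oper set" where
  mult: "(\<lambda>q. p * q) \<in> weyl"
| pdiff: "pdiff k \<in> weyl"
| add: "a \<in> weyl \<Longrightarrow> b \<in> weyl \<Longrightarrow> (\<lambda>q. a q + b q) \<in> weyl"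
| uminus: "a \<in> weyl \<Longrightarrow> (\<lambda>q. - a q) \<in> weyl"
| comp: "a \<in> weyl \<Longrightarrow> b \<in> weyl \<Longrightarrow> a \<circ> b \<in> weyl"

text \<open>
  \<open>weyl_bideg u v a\<close>: the operator \<open>a\<close> lies in the component of bidegree \<open>(u, v)\<close> of the
  Weyl algebra, that is, \<open>a\<close> is a sum of products of generators whose bidegrees add up to
  \<open>(u, v)\<close>. The zero operator lies in every component.
\<close>

inductive weyl_bideg :: "int \<Rightarrow> int \<Rightarrow> ('c::comm_ring_1, 'n, 'm) oper \<Rightarrow> bool" where
  const: "weyl_bideg 0 0 (\<lambda>q. Const c * q)"
| X: "weyl_bideg 1 0 (\<lambda>q. Var (Inl i) * q)"
| Y: "weyl_bideg 0 1 (\<lambda>q. Var (Inr j) * q)"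
| dX: "weyl_bideg (- 1) 0 (pdiff (Inl i))"
| dY: "weyl_bideg 0 (- 1) (pdiff (Inr j))"
| add: "weyl_bideg u v a \<Longrightarrow> weyl_bideg u v b \<Longrightarrow> weyl_bideg u v (\<lambda>q. a q + b q)"
| comp: "weyl_bideg u v a \<Longrightarrow> weyl_bideg u' v' b \<Longrightarrow> weyl_bideg (u + u') (v + v') (a \<circ> b)"

definition euler_X :: "('c::comm_ring_1, 'n::finite, 'm) oper" where
  "euler_X q = (\<Sum>i\<in>UNIV. Var (Inl i) * pdiff (Inl i) q)"

definition euler_Y :: "('c::comm_ring_1, 'n, 'm::finite) oper" where
  "euler_Y q = (\<Sum>j\<in>UNIV. Var (Inr j) * pdiff (Inr j) q)"


text \<open>
  Left modules over the Weyl algebra. The values of \<open>act\<close> outside \<open>weyl\<close> are irrelevant.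
\<close>

locale weyl_module =
  fixes act :: "('c::comm_ring_1, 'n::finite, 'm::finite) oper \<Rightarrow> 'e::ab_group_add \<Rightarrow> 'e"
  assumes act_add_right: "a \<in> weyl \<Longrightarrow> act a (x + y) = act a x + act a y"
    and act_add_left: "a \<in> weyl \<Longrightarrow> b \<in> weyl \<Longrightarrow> act (\<lambda>q. a q + b q) x = act a x + act b x"
    and act_comp: "a \<in> weyl \<Longrightarrow> b \<in> weyl \<Longrightarrow> act (a \<circ> b) x = act a (act b x)"
    and act_id: "act id x = x"

locale bigraded_weyl_module = weyl_module act
  for act :: "('c::comm_ring_1, 'n::finite, 'm::finite) oper \<Rightarrow> 'e::ab_group_add \<Rightarrow> 'e" +
  fixes M :: "int \<times> int \<Rightarrow> 'e set"
  assumes M_zero: "0 \<in> M w"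
    and M_add: "x \<in> M w \<Longrightarrow> y \<in> M w \<Longrightarrow> x + y \<in> M w"
    and M_uminus: "x \<in> M w \<Longrightarrow> - x \<in> M w"
    and M_direct_sum: "\<exists>!f. (\<forall>w. f w \<in> M w) \<and> finite {w. f w \<noteq> 0} \<and> x = (\<Sum>w | f w \<noteq> 0. f w)"
    and act_bideg: "weyl_bideg u v a \<Longrightarrow> x \<in> M (u', v') \<Longrightarrow> act a x \<in> M (u + u', v + v')"

locale generalized_eulerian = bigraded_weyl_module act M
  for act :: "('c::comm_ring_1, 'n::finite, 'm::finite) oper \<Rightarrow> 'e::ab_group_add \<Rightarrow> 'e"
    and M :: "int \<times> int \<Rightarrow> 'e set" +
  assumes eulerian: "e \<in> M (u, v) \<Longrightarrow>
    \<exists>a>0. act ((\<lambda>q. euler_X q - of_int u * q) ^^ a) e = 0 \<and>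
          act ((\<lambda>q. euler_Y q - of_int v * q) ^^ a) e = 0"


definition block :: "nat \<Rightarrow> nat \<Rightarrow> int \<times> int \<Rightarrow> (int \<times> int) set" where
  "block n m = (\<lambda>(u0, v0). {(u, v).
     (u0 \<ge> 0 \<longrightarrow> u \<ge> u0) \<and> (u0 \<le> - int n \<longrightarrow> u \<le> u0) \<and>
     (v0 \<ge> 0 \<longrightarrow> v \<ge> v0) \<and> (v0 \<le> - int m \<longrightarrow> v \<le> v0)})"

definition region_NE :: "(int \<times> int) set" where
  "region_NE = {(u, v). u \<ge> 0 \<and> v \<ge> 0}"

definition region_NW :: "nat \<Rightarrow> (int \<times> int) set" where
  "region_NW n = {(u, v). u \<le> - int n \<and> v \<ge> 0}"

definition region_SW :: "nat \<Rightarrow> nat \<Rightarrow> (int \<times> int) set" where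
  "region_SW n m = {(u, v). u \<le> - int n \<and> v \<le> - int m}"

definition region_SE :: "nat \<Rightarrow> (int \<times> int) set" where
  "region_SE m = {(u, v). u \<ge> 0 \<and> v \<le> - int m}"

end

theory Submission
  imports Defs
begin

text \<open>
  Since $\sum_i \partial_i X_i = \mathcal{E}^X_n + n$, a homogeneous element \<open>e\<close> of bidegree
  $(u,v)$ that is killed by all $\partial_i$ (all $X_i$) satisfies $\mathcal{E}^X_n e = 0$
  ($\mathcal{E}^X_n e = -n e$), whereas $\mathcal{E}^X_n - u$ acts nilpotently on it. In
  characteristic zero this forces $e = 0$, unless $u = 0$ ($u = -n$). So nonvanishing spreads
  along each row of the grading, and symmetrically along each column, and only the
  thresholds $0$ and $-n$ (respectively $-m$) can stop it.
\<close>

subsection \<open>Partial derivatives and Euler operators\<close>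

text \<open>Terms outside the support have coefficient 0. A common index set lets
  \<open>pdiff\<close> of two polynomials and of their sum be compared termwise.\<close>

lemma pdiff_superset:
  assumes "finite A" "Poly_Mapping.keys p \<subseteq> A"
  shows "pdiff k p = (\<Sum>t\<in>A. Poly_Mapping.single (t - Poly_Mapping.single k 1)
       (of_nat (Poly_Mapping.lookup t k) * Poly_Mapping.lookup p t))"
  unfolding pdiff_def using assms
  by (intro sum.mono_neutral_left) (auto simp: in_keys_iff)

lemma additive_pdiff: "additive (pdiff k :: ('c::comm_ring_1, 'n, 'm) oper)"
proof
  fix p q :: "('c, 'n, 'm) mpol"
  let ?A = "Poly_Mapping.keys p \<union> Poly_Mapping.keys q"
  show "pdiff k (p + q) = pdiff k p + pdiff k q"
    using pdiff_superset[of ?A p k] pdiff_superset[of ?A q k] pdiff_superset[of ?A "p + q" k]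
      keys_add[of p q]
    by (simp add: lookup_add distrib_left single_add sum.distrib)
qed

lemma additive_of_int_mult:
  fixes f :: "'a::ring_1 \<Rightarrow> 'b::ring_1"
  assumes "additive f"
  shows "f (of_int k * x) = of_int k * f x"
proof -
  interpret additive f by fact
  show ?thesis
    by (induction k rule: int_induct[where k = 0])
      (simp_all add: zero add diff distrib_right left_diff_distrib)
qed

lemma mpol_eq_sum_single:
  "p = (\<Sum>t\<in>Poly_Mapping.keys p. Poly_Mapping.single t (Poly_Mapping.lookup p t))"
  by (rule poly_mapping_eqI)
    (auto simp: lookup_sum lookup_single when_def in_keys_iff if_distrib sum.delta
          cong: if_cong)

text \<open>If \<open>k\<close> does not occur in \<open>t\<close>, the derivative of the monomial
  vanishes. Otherwise its exponent is positive and the truncated subtraction can be undone.\<close>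

lemma pdiff_Var_mult_single:
  "pdiff k (Var k * Poly_Mapping.single t c) =
     Poly_Mapping.single t c + Var k * pdiff k (Poly_Mapping.single t c)"
proof (cases "Poly_Mapping.lookup t k = 0")
  case True
  then show ?thesis
    by (simp add: Var_def mult_single pdiff_single lookup_add)
next
  case False
  have "Poly_Mapping.single k 1 + (t - Poly_Mapping.single k 1) = t"
    using False
    by (intro poly_mapping_eqI) (auto simp: lookup_add lookup_minus lookup_single when_def)
  then show ?thesis
    by (simp add: Var_def mult_single pdiff_single lookup_add single_add distrib_right)
qed

text \<open>The defining Weyl relation, extended from monomials by additivity.\<close>

lemma pdiff_Var_mult: "pdiff k (Var k * p) = p + Var k * pdiff k p"
proof -
  interpret additive "pdiff k" by (rule additive_pdiff)
  have "pdiff k (Var k * p) =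
      (\<Sum>t\<in>Poly_Mapping.keys p. pdiff k (Var k * Poly_Mapping.single t (Poly_Mapping.lookup p t)))"
    by (subst arg_cong[OF mpol_eq_sum_single, of "\<lambda>q. pdiff k (Var k * q)"])
      (simp only: sum_distrib_left sum)
  also have "\<dots> = (\<Sum>t\<in>Poly_Mapping.keys p. Poly_Mapping.single t (Poly_Mapping.lookup p t)) +
      Var k * pdiff k (\<Sum>t\<in>Poly_Mapping.keys p. Poly_Mapping.single t (Poly_Mapping.lookup p t))"
    by (simp only: pdiff_Var_mult_single sum.distrib sum sum_distrib_left)
  finally show ?thesis
    by (simp only: mpol_eq_sum_single[symmetric])
qed

text \<open>Taking an arbitrary set of variables lets one argument serve both Euler
  operators.\<close>

definition euler :: "('n + 'm) set \<Rightarrow> ('c::comm_ring_1, 'n, 'm) oper" where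
  "euler S q = (\<Sum>k\<in>S. Var k * pdiff k q)"

lemma euler_X_eq: "euler_X = euler (range Inl)"
  by (rule ext) (simp add: euler_X_def euler_def sum.reindex)

lemma euler_Y_eq: "euler_Y = euler (range Inr)"
  by (rule ext) (simp add: euler_Y_def euler_def sum.reindex)

lemma additive_euler: "additive (euler S)"
  by standard (simp add: euler_def additive.add[OF additive_pdiff] distrib_left sum.distrib)

text \<open>Each variable contributes 1 through its Weyl relation; this shift is the source of the
  thresholds -n and -m.\<close>

lemma sum_pdiff_Var_mult: "(\<Sum>k\<in>S. pdiff k (Var k * q)) = euler S q + of_nat (card S) * q"
  by (simp add: add.commute pdiff_Var_mult sum.distrib euler_def)

section \<open>Closure properties of the Weyl algebra\<close>

lemma weyl_zero: "(\<lambda>q. 0) \<in> weyl"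
  using weyl.mult[of 0] by (simp only: lambda_zero)

lemma weyl_id: "id \<in> weyl"
  using weyl.mult[of 1] by (simp only: id_def lambda_one)

lemma weyl_sum:
  assumes "finite S" "\<And>k. k \<in> S \<Longrightarrow> f k \<in> weyl"
  shows "(\<lambda>q. \<Sum>k\<in>S. f k q) \<in> weyl"
  using assms
proof (induction S rule: finite_induct)
  case empty
  then show ?case by (simp add: weyl_zero)
qed (simp add: weyl.add)

lemma weyl_Var_pdiff: "(\<lambda>q. Var k * pdiff k q) \<in> weyl"
  using weyl.comp[OF weyl.mult weyl.pdiff] by (simp add: comp_def)

lemma weyl_pdiff_Var: "(\<lambda>q. pdiff k (Var k * q)) \<in> weyl"
  using weyl.comp[OF weyl.pdiff weyl.mult] by (simp add: comp_def)

lemma weyl_euler: "finite S \<Longrightarrow> euler S \<in> weyl"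
  using weyl_sum[OF _ weyl_Var_pdiff, of S] by (simp add: euler_def[abs_def])

lemma weyl_funpow: "a \<in> weyl \<Longrightarrow> a ^^ k \<in> weyl"
proof (induction k)
  case 0
  show ?case using weyl_id by (simp add: id_def)
qed (simp add: weyl.comp)

text \<open>Positive integers lie in the subfield and are nonzero there, hence invertible; the
  inverse absorbs the sign of \<open>d\<close>.\<close>

lemma of_int_invertible:
  assumes "contains_char_0_field TYPE('c::comm_ring_1)" "d \<noteq> 0"
  shows "\<exists>y :: 'c. y * of_int d = 1"
proof -
  obtain K :: "'c set" where K: "is_subfield K"
    and char0: "\<And>k::nat. k > 0 \<Longrightarrow> (of_nat k :: 'c) \<noteq> 0"
    using assms(1) unfolding contains_char_0_field_def by blast
  have nat_in: "(of_nat k :: 'c) \<in> K" for k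
    using K by (induction k) (auto simp: is_subfield_def)
  have inv: "\<exists>y :: 'c. y * of_nat k = 1" if "k > 0" for k
    using K nat_in[of k] char0[OF that] unfolding is_subfield_def by (metis mult.commute)
  from inv[of "nat \<bar>d\<bar>"] obtain y :: 'c where "y * of_nat (nat \<bar>d\<bar>) = 1"
    using assms(2) by auto
  then have "y * of_int \<bar>d\<bar> = 1" by (metis abs_ge_zero of_int_of_nat_eq int_nat_eq)
  then have "(if d < 0 then - y else y) * of_int d = 1"
    by (auto split: if_splits)
  then show ?thesis ..
qed

subsection \<open>Spreading of nonvanishing\<close>

context weyl_module
begin

lemma act_zero_right: "a \<in> weyl \<Longrightarrow> act a 0 = 0"
  using act_add_right[of a 0 0] by simp

lemma act_zero_left: "act (\<lambda>q. 0) x = 0"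
  using act_add_left[of "\<lambda>q. 0" "\<lambda>q. 0" x] by (simp add: weyl_zero)

lemma act_sum_eq_zero:
  assumes "finite S" "\<And>k. k \<in> S \<Longrightarrow> f k \<in> weyl" "\<And>k. k \<in> S \<Longrightarrow> act (f k) x = 0"
  shows "act (\<lambda>q. \<Sum>k\<in>S. f k q) x = 0"
  using assms
proof (induction S rule: finite_induct)
  case (insert k S)
  then show ?case
    using act_add_left[of "f k" "\<lambda>q. \<Sum>k\<in>S. f k q" x] weyl_sum[of S f] by simp
qed (simp add: act_zero_left)

text \<open>On an eigenvector with eigenvalue \<open>c\<close>, the operator
  \<open>(E - u)^a\<close> acts as \<open>(c - u)^a\<close>, which is a unit in characteristic zero.
  Scalars appear as multiplication operators because \<open>act\<close> is the only scalar action on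
  the module.\<close>

lemma eigenvector_eq_zero:
  assumes char0: "contains_char_0_field TYPE('c)"
    and E: "E \<in> weyl" "additive E"
    and eig: "act (\<lambda>q. E q - of_int c * q) x = 0"
    and nil: "act ((\<lambda>q. E q - of_int u * q) ^^ a) x = 0"
    and "c \<noteq> u"
  shows "x = 0"
proof -
  have mult_weyl: "(\<lambda>q. of_int d * q) \<in> weyl" for d
    by (rule weyl.mult)
  have shift_weyl: "(\<lambda>q. E q - of_int d * q) \<in> weyl" for d
    using weyl.add[OF E(1) mult_weyl[of "- d"]] by simp
  define F where "F = (\<lambda>q. E q - of_int u * q)"
  have F: "F \<in> weyl"
    unfolding F_def by (rule shift_weyl)
  have "additive F"
    using additive.add[OF E(2)] by unfold_locales (simp add: F_def algebra_simps)
  then have "additive (F ^^ k)" for k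
    by (induction k) (simp_all add: additive_def)
  \<comment> \<open>Additive maps commute with integer multiples, so the scalar can be moved past
    the remaining power of \<open>F\<close> in the induction below.\<close>
  then have comm: "(F ^^ k) \<circ> (\<lambda>q. of_int d * q) = (\<lambda>q. of_int d * q) \<circ> (F ^^ k)" for k d
    by (simp add: fun_eq_iff additive_of_int_mult)
  \<comment> \<open>Write \<open>F\<close> as \<open>E - c\<close> plus the scalar
    \<open>c - u\<close>; the first summand kills \<open>x\<close>.\<close>
  have eig': "act F x = act (\<lambda>q. of_int (c - u) * q) x"
    using act_add_left[OF shift_weyl[of c] mult_weyl[of "c - u"], of x] eig
    by (simp add: F_def algebra_simps)
  have pow: "act (F ^^ k) x = act (\<lambda>q. of_int ((c - u) ^ k) * q) x" for k
  proof (induction k)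
    case 0
    show ?case by (simp add: id_def)
  next
    case (Suc k)
    have "act (F ^^ Suc k) x = act (F ^^ k) (act F x)"
      by (simp only: funpow_Suc_right act_comp weyl_funpow F)
    also have "\<dots> = act ((\<lambda>q. of_int (c - u) * q) \<circ> (F ^^ k)) x"
      by (simp only: eig' flip: act_comp[OF weyl_funpow[OF F] mult_weyl] comm)
    also have "\<dots> = act ((\<lambda>q. of_int (c - u) * q) \<circ> (\<lambda>q. of_int ((c - u) ^ k) * q)) x"
      by (simp only: Suc act_comp mult_weyl weyl_funpow F)
    finally show ?case
      by (simp add: comp_def mult.assoc)
  qed
  obtain y :: 'c where "y * of_int ((c - u) ^ a) = 1"
    using of_int_invertible[OF char0, of "(c - u) ^ a"] \<open>c \<noteq> u\<close> by auto
  then have "Const y * of_int ((c - u) ^ a) = (1 :: ('c, 'n, 'm) mpol)"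
    unfolding Const_def by (metis mult_single single_of_int single_one add.left_neutral)
  \<comment> \<open>The identity factors through the scalar by which the nilpotent power acts, so
    \<open>x\<close> is the image of 0.\<close>
  then have "id = (\<lambda>q :: ('c, 'n, 'm) mpol. Const y * q) \<circ> (\<lambda>q. of_int ((c - u) ^ a) * q)"
    by (simp add: fun_eq_iff flip: mult.assoc)
  then have "x = act (\<lambda>q. Const y * q) (act (\<lambda>q. of_int ((c - u) ^ a) * q) x)"
    by (metis act_id act_comp weyl.mult)
  also have "\<dots> = 0"
    using nil pow[of a] by (simp add: F_def act_zero_right weyl.mult)
  finally show ?thesis .
qed

text \<open>Each summand of the Euler operator applies a derivative first, so \<open>x\<close> is an
  eigenvector with eigenvalue 0.\<close>

lemma eq_zero_if_pdiff_eq_zero: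
  assumes char0: "contains_char_0_field TYPE('c)" and "finite S"
    and kill: "\<And>k. k \<in> S \<Longrightarrow> act (pdiff k) x = 0"
    and nil: "act ((\<lambda>q. euler S q - of_int u * q) ^^ a) x = 0" and "u \<noteq> 0"
  shows "x = 0"
proof (rule eigenvector_eq_zero[OF char0 weyl_euler additive_euler _ nil])
  have "act (\<lambda>q. Var k * pdiff k q) x = 0" if "k \<in> S" for k
    using act_comp[OF weyl.mult[of "Var k"] weyl.pdiff[of k], of x] kill[OF that]
    by (simp add: comp_def act_zero_right weyl.mult)
  then show "act (\<lambda>q. euler S q - of_int 0 * q) x = 0"
    using act_sum_eq_zero[OF \<open>finite S\<close> weyl_Var_pdiff] by (simp add: euler_def)
qed (use assms in auto)

text \<open>The sum of the operators \<open>pdiff k\<close> after \<open>Var k\<close> kills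
  \<open>x\<close> and equals the Euler operator plus \<open>card S\<close>, so the eigenvalue is
  \<open>- card S\<close>.\<close>

lemma eq_zero_if_Var_eq_zero:
  assumes char0: "contains_char_0_field TYPE('c)" and "finite S"
    and kill: "\<And>k. k \<in> S \<Longrightarrow> act (\<lambda>q. Var k * q) x = 0"
    and nil: "act ((\<lambda>q. euler S q - of_int u * q) ^^ a) x = 0" and "u \<noteq> - int (card S)"
  shows "x = 0"
proof (rule eigenvector_eq_zero[OF char0 weyl_euler additive_euler _ nil])
  have "act (\<lambda>q. pdiff k (Var k * q)) x = 0" if "k \<in> S" for k
    using act_comp[OF weyl.pdiff[of k] weyl.mult[of "Var k"], of x] kill[OF that]
    by (simp add: comp_def act_zero_right weyl.pdiff)
  then show "act (\<lambda>q. euler S q - of_int (- int (card S)) * q) x = 0"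
    using act_sum_eq_zero[of S "\<lambda>k q. pdiff k (Var k * q)" x] \<open>finite S\<close>
    by (simp add: sum_pdiff_Var_mult weyl_pdiff_Var)
qed (use assms in auto)

end

context generalized_eulerian
begin

lemma nonzero_iff: "M w \<noteq> {0} \<longleftrightarrow> (\<exists>x\<in>M w. x \<noteq> 0)"
  using M_zero[of w] by blast

context
  assumes char0: "contains_char_0_field TYPE('c)"
begin

text \<open>Away from the exceptional degree, some derivative (some variable) does not kill a
  nonzero \<open>x\<close>, and the image lies in the neighbouring component.\<close>

lemma nonzero_step_X:
  assumes "M (u, v) \<noteq> {0}"
  shows "u \<noteq> 0 \<Longrightarrow> M (u - 1, v) \<noteq> {0}"
    and "u \<noteq> - int CARD('n) \<Longrightarrow> M (u + 1, v) \<noteq> {0}"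
proof -
  obtain x a where x: "x \<in> M (u, v)" "x \<noteq> 0"
    and nil: "act ((\<lambda>q. euler (range Inl) q - of_int u * q) ^^ a) x = 0"
    using assms eulerian unfolding nonzero_iff euler_X_eq by blast
  have card: "card (range Inl :: ('n + 'm) set) = CARD('n)"
    by (simp add: card_image)
  show "M (u - 1, v) \<noteq> {0}" if u: "u \<noteq> 0"
  proof -
    obtain i where "act (pdiff (Inl i)) x \<noteq> 0"
      using eq_zero_if_pdiff_eq_zero[OF char0 finite _ nil u] x(2) by blast
    moreover have "act (pdiff (Inl i)) x \<in> M (u - 1, v)"
      using act_bideg[OF weyl_bideg.dX x(1)] by simp
    ultimately show ?thesis unfolding nonzero_iff by blast
  qed
  show "M (u + 1, v) \<noteq> {0}" if u: "u \<noteq> - int CARD('n)"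
  proof -
    obtain i where "act (\<lambda>q. Var (Inl i) * q) x \<noteq> 0"
      using eq_zero_if_Var_eq_zero[OF char0 finite _ nil] u x(2) unfolding card by blast
    moreover have "act (\<lambda>q. Var (Inl i) * q) x \<in> M (u + 1, v)"
      using act_bideg[OF weyl_bideg.X x(1)] by (simp add: add.commute)
    ultimately show ?thesis unfolding nonzero_iff by blast
  qed
qed

lemma nonzero_step_Y:
  assumes "M (u, v) \<noteq> {0}"
  shows "v \<noteq> 0 \<Longrightarrow> M (u, v - 1) \<noteq> {0}"
    and "v \<noteq> - int CARD('m) \<Longrightarrow> M (u, v + 1) \<noteq> {0}"
proof -
  obtain x a where x: "x \<in> M (u, v)" "x \<noteq> 0"
    and nil: "act ((\<lambda>q. euler (range Inr) q - of_int v * q) ^^ a) x = 0"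
    using assms eulerian unfolding nonzero_iff euler_Y_eq by blast
  have card: "card (range Inr :: ('n + 'm) set) = CARD('m)"
    by (simp add: card_image)
  show "M (u, v - 1) \<noteq> {0}" if v: "v \<noteq> 0"
  proof -
    obtain j where "act (pdiff (Inr j)) x \<noteq> 0"
      using eq_zero_if_pdiff_eq_zero[OF char0 finite _ nil v] x(2) by blast
    moreover have "act (pdiff (Inr j)) x \<in> M (u, v - 1)"
      using act_bideg[OF weyl_bideg.dY x(1)] by simp
    ultimately show ?thesis unfolding nonzero_iff by blast
  qed
  show "M (u, v + 1) \<noteq> {0}" if v: "v \<noteq> - int CARD('m)"
  proof -
    obtain j where "act (\<lambda>q. Var (Inr j) * q) x \<noteq> 0"
      using eq_zero_if_Var_eq_zero[OF char0 finite _ nil] v x(2) unfolding card by blast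
    moreover have "act (\<lambda>q. Var (Inr j) * q) x \<in> M (u, v + 1)"
      using act_bideg[OF weyl_bideg.Y x(1)] by (simp add: add.commute)
    ultimately show ?thesis unfolding nonzero_iff by blast
  qed
qed

end

end

section \<open>From unit steps to whole regions\<close>

lemma int_spread:
  fixes P :: "int \<Rightarrow> bool"
  assumes "P k"
    and down: "\<And>i. P i \<Longrightarrow> i \<noteq> 0 \<Longrightarrow> P (i - 1)"
    and up: "\<And>i. P i \<Longrightarrow> i \<noteq> l \<Longrightarrow> P (i + 1)"
    and "l < 0" and sides: "k \<ge> 0 \<and> i \<ge> 0 \<or> k \<le> l \<and> i \<le> l"
  shows "P i"
  using sides
proof
  assume "k \<ge> 0 \<and> i \<ge> 0"
  \<comment> \<open>The induction runs both ways from \<open>k\<close>. The guard makes negative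
    targets vacuous, so \<open>down\<close> is used only at positive integers, and \<open>up\<close>
    never meets \<open>l < 0\<close>.\<close>
  moreover from this have "i \<ge> 0 \<longrightarrow> P i"
    by (induction i rule: int_induct[where k = k]) (use assms in auto)
  ultimately show ?thesis by blast
next
  assume "k \<le> l \<and> i \<le> l"
  \<comment> \<open>Here the guard stops the ascent at \<open>l\<close>, and \<open>down\<close>
    never meets 0.\<close>
  moreover from this have "i \<le> l \<longrightarrow> P i"
    by (induction i rule: int_induct[where k = k]) (use assms in auto)
  ultimately show ?thesis by blast
qed

text \<open>Move along the row to column \<open>u'\<close> first, then along that column to
  \<open>v'\<close>.\<close>

lemma (in generalized_eulerian) nonzero_spread:
  assumes char0: "contains_char_0_field TYPE('c)"
    and "M (u, v) \<noteq> {0}"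
    and "u \<ge> 0 \<and> u' \<ge> 0 \<or> u \<le> - int CARD('n) \<and> u' \<le> - int CARD('n)"
    and "v \<ge> 0 \<and> v' \<ge> 0 \<or> v \<le> - int CARD('m) \<and> v' \<le> - int CARD('m)"
  shows "M (u', v') \<noteq> {0}"
proof -
  have "M (u', v) \<noteq> {0}"
    by (rule int_spread[where P = "\<lambda>i. M (i, v) \<noteq> {0}" and l = "- int CARD('n)"])
      (use assms nonzero_step_X[OF char0] in auto)
  then show ?thesis
    by (rule int_spread[where P = "\<lambda>j. M (u', j) \<noteq> {0}" and l = "- int CARD('m)"])
      (use assms nonzero_step_Y[OF char0] in auto)
qed

theorem theorem5p8:
  fixes act :: "('c::comm_ring_1, 'n::finite, 'm::finite) oper \<Rightarrow> 'e::ab_group_add \<Rightarrow> 'e"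
    and M :: "int \<times> int \<Rightarrow> 'e set"
    and Reg :: "(int \<times> int) set"
  assumes "noetherian_type TYPE('c)"
    and "contains_char_0_field TYPE('c)"
    and "generalized_eulerian act M"
    and "Reg \<in> {region_NE, region_NW CARD('n), region_SW CARD('n) CARD('m), region_SE CARD('m)}"
  shows "((\<exists>w0\<in>Reg. \<forall>w\<in>block CARD('n) CARD('m) w0. M w \<noteq> {0}) \<longleftrightarrow> (\<forall>w\<in>Reg. M w \<noteq> {0})) \<and>
         ((\<forall>w\<in>Reg. M w \<noteq> {0}) \<longleftrightarrow> (\<exists>w1\<in>Reg. M w1 \<noteq> {0}))"
proof -
  interpret generalized_eulerian act M by fact
  note defs = region_NE_def region_NW_def region_SW_def region_SE_def block_def
  consider (NE) "Reg = region_NE" | (NW) "Reg = region_NW CARD('n)"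
    | (SW) "Reg = region_SW CARD('n) CARD('m)" | (SE) "Reg = region_SE CARD('m)"
    using assms(4) by blast
  note reg_cases = this
  \<comment> \<open>This is (c) implies (b): two points of one region lie on the same side of the
    thresholds in each coordinate.\<close>
  have all: "\<forall>w\<in>Reg. M w \<noteq> {0}" if w1: "w1 \<in> Reg" "M w1 \<noteq> {0}" for w1
  proof
    fix w assume w: "w \<in> Reg"
    obtain u v where uv: "w1 = (u, v)" by (cases w1)
    obtain u' v' where uv': "w = (u', v')" by (cases w)
    have "(u \<ge> 0 \<and> u' \<ge> 0 \<or> u \<le> - int CARD('n) \<and> u' \<le> - int CARD('n)) \<and>
        (v \<ge> 0 \<and> v' \<ge> 0 \<or> v \<le> - int CARD('m) \<and> v' \<le> - int CARD('m))"
      using w1(1) w unfolding uv uv' by (cases rule: reg_cases) (simp_all add: defs)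
    then show "M w \<noteq> {0}"
      using nonzero_spread[OF assms(2), of u v u' v'] w1(2) unfolding uv uv' by blast
  qed
  \<comment> \<open>Reduces (a) to (c), with \<open>w0\<close> itself as the nonzero
    component.\<close>
  have mem: "w0 \<in> block CARD('n) CARD('m) w0" for w0
    by (auto simp: block_def)
  \<comment> \<open>For (b) implies (a), the witness is the corner of the region.\<close>
  have "\<exists>w0\<in>Reg. block CARD('n) CARD('m) w0 \<subseteq> Reg"
  proof (cases rule: reg_cases)
    case NE
    then show ?thesis by (intro bexI[of _ "(0, 0)"]) (auto simp: defs)
  next
    case NW
    then show ?thesis by (intro bexI[of _ "(- int CARD('n), 0)"]) (auto simp: defs)
  next
    case SW
    then show ?thesis by (intro bexI[of _ "(- int CARD('n), - int CARD('m))"]) (auto simp: defs)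
  next
    case SE
    then show ?thesis by (intro bexI[of _ "(0, - int CARD('m))"]) (auto simp: defs)
  qed
  then obtain w0 where w0: "w0 \<in> Reg" "block CARD('n) CARD('m) w0 \<subseteq> Reg"
    by blast
  show ?thesis
  proof (intro conjI iffI)
    assume "\<exists>w0\<in>Reg. \<forall>w\<in>block CARD('n) CARD('m) w0. M w \<noteq> {0}"
    then show "\<forall>w\<in>Reg. M w \<noteq> {0}"
      using all mem by meson
  next
    assume "\<forall>w\<in>Reg. M w \<noteq> {0}"
    then show "\<exists>w0\<in>Reg. \<forall>w\<in>block CARD('n) CARD('m) w0. M w \<noteq> {0}"
      using w0 by (meson subsetD)
  next
    assume "\<forall>w\<in>Reg. M w \<noteq> {0}"
    then show "\<exists>w1\<in>Reg. M w1 \<noteq> {0}"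
      using w0(1) by meson
  next
    assume "\<exists>w1\<in>Reg. M w1 \<noteq> {0}"
    then show "\<forall>w\<in>Reg. M w \<noteq> {0}"
      using all by meson
  qed
qed

end
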